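(* The valuation $\mathsf V=\lambda(\mathsf E+\gamma\cdot\mathsf{Var})+(1-\lambda)\mathsf V^\nu$, with $0<\lambda\le1$, where $\nu$ is increasing and strictly convex, and with $\gamma>0$, is $\mathsf E$-strictly concave.
   Context: A game with $n$ players has finite strategy sets $S_i$ and cost functions $\mu_i:\mathcal S=\prod_{i\in[n]}S_i\to\mathbb R$. $\Delta(S_i)$ is the set of mixed strategies. A mixed profile $\mathbf p=\langle p_1,\dots,p_n\rangle$ induces $\mathbf p(\mathbf s)=\prod_i p_i(s_i)$; $\mathbf p_{-i}$ is $\mathbf p$ with $p_i$ removed. $\mathsf E_i(\mathbf p)=\sum_{\mathbf s}\mathbf p(\mathbf s)\mu_i(\mathbf s)$, $\mathsf{Var}_i(\mathbf p)=\sum_{\mathbf s}\mathbf p(\mathbf s)(\mu_i(\mathbf s)-\mathsf E_i(\mathbf p))^2$, and $\mathsf V^\nu_i(\mathbf p)=\nu^{-1}\big(\sum_{\mathbf s}\mathbf p(\mathbf s)\,\nu(\mu_i(\mathbf s))\big)$, where $\nu$ is a continuous real function on an interval containing all the costs of the games considered (so that $\mathsf V^\nu$ is well defined). An $(\mathsf E+\mathsf R)$-valuation is $\mathsf V=\mathsf E+\mathsf R$ with $\mathsf R$ continuous, $\mathsf R_i(\mathbf p)\ge0$ always, and $\mathsf R_i(\mathbf p)=0$ if and only if $\mu_i$ is constant on $\{\mathbf s:\mathbf p(\mathbf s)>0\}$. An $(\mathsf E+\mathsf R)$-valuation $\mathsf V$ is $\mathsf E$-strictly concave if for every game, every player $i$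 and every fixed $\mathbf p_{-i}$: (1) $\mathsf V_i(\cdot,\mathbf p_{-i})$ is concave on $\Delta(S_i)$; (2) for all $p_i',p_i''\in\Delta(S_i)$ with $\mathsf E_i(p_i',\mathbf p_{-i})\ne\mathsf E_i(p_i'',\mathbf p_{-i})$ and all $0<t<1$, $\mathsf V_i(tp_i'+(1-t)p_i'',\mathbf p_{-i})>t\,\mathsf V_i(p_i',\mathbf p_{-i})+(1-t)\mathsf V_i(p_i'',\mathbf p_{-i})$. *)

theory Defs
  imports "HOL-Analysis.Analysis"
begin

text \<open>
  The players are \<open>0, \<dots>, n - 1\<close>; strategies of all players are drawn from one type, and
  \<open>strategies G i\<close> is the strategy set of player \<open>i\<close>.
\<close>

record 's game =
  num_players :: nat
  strategies :: "nat \<Rightarrow> 's set"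
  cost :: "nat \<Rightarrow> (nat \<Rightarrow> 's) \<Rightarrow> real"

definition is_game :: "'s game \<Rightarrow> bool" where
  "is_game G \<longleftrightarrow>
     (\<forall>i<num_players G. finite (strategies G i) \<and> strategies G i \<noteq> {})"

definition profiles :: "'s game \<Rightarrow> (nat \<Rightarrow> 's) set" where
  "profiles G = PiE {..<num_players G} (strategies G)"

definition mixed_strategies :: "'s set \<Rightarrow> ('s \<Rightarrow> real) set" where
  "mixed_strategies S =
     {q. (\<forall>s\<in>S. 0 \<le> q s) \<and> (\<forall>s. s \<notin> S \<longrightarrow> q s = 0) \<and> (\<Sum>s\<in>S. q s) = 1}"

definition mixed_profiles :: "'s game \<Rightarrow> (nat \<Rightarrow> 's \<Rightarrow> real) set" where
  "mixed_profiles G = PiE {..<num_players G} (\<lambda>i. mixed_strategies (strategies G i))"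

definition profile_prob :: "'s game \<Rightarrow> (nat \<Rightarrow> 's \<Rightarrow> real) \<Rightarrow> (nat \<Rightarrow> 's) \<Rightarrow> real" where
  "profile_prob G p s = (\<Prod>i<num_players G. p i (s i))"

text \<open>A valuation is only meaningful for a player of the game and a mixed profile of the game.\<close>

type_synonym 's valuation = "'s game \<Rightarrow> nat \<Rightarrow> (nat \<Rightarrow> 's \<Rightarrow> real) \<Rightarrow> real"

definition Exp_val :: "'s valuation" where
  "Exp_val G i p = (\<Sum>s\<in>profiles G. profile_prob G p s * cost G i s)"

definition Var_val :: "'s valuation" where
  "Var_val G i p = (\<Sum>s\<in>profiles G. profile_prob G p s * (cost G i s - Exp_val G i p)\<^sup>2)"

text \<open>
  Here \<open>\<nu>\<close> is considered on \<open>I\<close> only, and its inverse is taken there.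
\<close>

definition nu_val :: "real set \<Rightarrow> (real \<Rightarrow> real) \<Rightarrow> 's valuation" where
  "nu_val I \<nu> G i p = inv_into I \<nu> (\<Sum>s\<in>profiles G. profile_prob G p s * \<nu> (cost G i s))"

definition games_with_costs_in :: "real set \<Rightarrow> 's game set" where
  "games_with_costs_in I =
     {G. is_game G \<and> (\<forall>i<num_players G. \<forall>s\<in>profiles G. cost G i s \<in> I)}"

text \<open>
  The properties of valuations are relative to the class \<open>\<G>\<close> of games considered.  Continuity is
  continuity in the mixed profile: on \<open>mixed_profiles G\<close> the product topology of the function type
  is the Euclidean topology of the finitely many probabilities \<open>p i s\<close>.
\<close>

definition ER_valuation :: "'s game set \<Rightarrow> 's valuation \<Rightarrow> bool" where
  "ER_valuation \<G> V \<longleftrightarrow>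
     (\<exists>R :: 's valuation. \<forall>G\<in>\<G>. \<forall>i<num_players G.
        continuous_on (mixed_profiles G) (R G i) \<and>
        (\<forall>p\<in>mixed_profiles G.
           V G i p = Exp_val G i p + R G i p \<and>
           0 \<le> R G i p \<and>
           (R G i p = 0 \<longleftrightarrow> cost G i constant_on {s \<in> profiles G. 0 < profile_prob G p s})))"

definition mix :: "real \<Rightarrow> ('s \<Rightarrow> real) \<Rightarrow> ('s \<Rightarrow> real) \<Rightarrow> 's \<Rightarrow> real" where
  "mix t q r = (\<lambda>s. t * q s + (1 - t) * r s)"

text \<open>
  Fixing \<open>p\<^sub>-\<^sub>i\<close> and varying the strategy of player \<open>i\<close> is rendered by the updates \<open>p(i := q)\<close> of a
  mixed profile \<open>p\<close>, whose own entry at \<open>i\<close> is irrelevant.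
\<close>

definition E_strictly_concave :: "'s game set \<Rightarrow> 's valuation \<Rightarrow> bool" where
  "E_strictly_concave \<G> V \<longleftrightarrow>
     ER_valuation \<G> V \<and>
     (\<forall>G\<in>\<G>. \<forall>i<num_players G. \<forall>p\<in>mixed_profiles G.
        (\<forall>q\<in>mixed_strategies (strategies G i). \<forall>r\<in>mixed_strategies (strategies G i).
           \<forall>t. 0 \<le> t \<and> t \<le> 1 \<longrightarrow>
             V G i (p(i := mix t q r)) \<ge> t * V G i (p(i := q)) + (1 - t) * V G i (p(i := r))) \<and>
        (\<forall>q\<in>mixed_strategies (strategies G i). \<forall>r\<in>mixed_strategies (strategies G i).
           Exp_val G i (p(i := q)) \<noteq> Exp_val G i (p(i := r)) \<longrightarrow>
           (\<forall>t. 0 < t \<and> t < 1 \<longrightarrow>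
             V G i (p(i := mix t q r)) > t * V G i (p(i := q)) + (1 - t) * V G i (p(i := r)))))"

definition strictly_convex_on :: "real set \<Rightarrow> (real \<Rightarrow> real) \<Rightarrow> bool" where
  "strictly_convex_on I f \<longleftrightarrow>
     (\<forall>x\<in>I. \<forall>y\<in>I. \<forall>t. x \<noteq> y \<and> 0 < t \<and> t < 1 \<longrightarrow>
        f (t * x + (1 - t) * y) < t * f x + (1 - t) * f y)"

end

theory Submission
  imports Defs
begin

text \<open>
  Expectations are affine in the strategy of a single player, so that the variance of a mixture with
  weights \<open>t\<close> and \<open>1 - t\<close> exceeds the mixture of the variances by exactly \<open>t (1 - t)\<close> times the
  squared difference of the two expectations; this is the source of strictness.  The inverse of an
  increasing convex function is concave, so the \<open>\<nu>\<close>-valuation is concave, and Jensen's inequality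
  makes it at least the expectation.
\<close>

text \<open>Taking an arbitrary function of the pure profile lets the cost, its square and \<nu> of
  the cost share the same lemmas.\<close>

definition mean :: "'s game \<Rightarrow> (nat \<Rightarrow> 's \<Rightarrow> real) \<Rightarrow> ((nat \<Rightarrow> 's) \<Rightarrow> real) \<Rightarrow> real" where
  "mean G p f = (\<Sum>s\<in>profiles G. profile_prob G p s * f s)"

lemma Exp_val_eq_mean: "Exp_val G i p = mean G p (cost G i)"
  by (simp add: Exp_val_def mean_def)

lemma nu_val_eq_mean: "nu_val I \<nu> G i p = inv_into I \<nu> (mean G p (\<lambda>s. \<nu> (cost G i s)))"
  by (simp add: nu_val_def mean_def)

section \<open>The product distribution on pure profiles\<close>

lemma finite_profiles: "is_game G \<Longrightarrow> finite (profiles G)"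
  by (auto simp: is_game_def profiles_def intro: finite_PiE)

lemma profile_prob_nonneg:
  assumes "p \<in> mixed_profiles G" "s \<in> profiles G"
  shows "0 \<le> profile_prob G p s"
  unfolding profile_prob_def using assms
  by (intro prod_nonneg) (auto simp: mixed_profiles_def profiles_def mixed_strategies_def PiE_def Pi_def)

lemma sum_profile_prob:
  assumes "is_game G" "p \<in> mixed_profiles G"
  shows "(\<Sum>s\<in>profiles G. profile_prob G p s) = 1"
proof -
  let ?N = "{..<num_players G}"
  have fin: "finite (strategies G i)" if "i \<in> ?N" for i
    using assms that by (auto simp: is_game_def)
  \<comment> \<open>On a finite set \<open>infsum\<close> is the ordinary sum; passing to it gives
    access to \<open>infsum_prod_PiE\<close>, which factors the total mass into one factor per
    player.\<close>
  have "(\<Sum>s\<in>profiles G. profile_prob G p s)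
      = infsum (\<lambda>s. \<Prod>i\<in>?N. p i (s i)) (PiE ?N (strategies G))"
    using finite_profiles[OF assms(1)] by (simp add: profiles_def profile_prob_def)
  also have "\<dots> = (\<Prod>i\<in>?N. infsum (p i) (strategies G i))"
    using finite_profiles[OF assms(1)]
    by (intro infsum_prod_PiE) (auto simp: profiles_def fin intro: summable_on_finite)
  also have "\<dots> = 1"
    using assms fin by (intro prod.neutral) (auto simp: mixed_profiles_def mixed_strategies_def PiE_def Pi_def)
  finally show ?thesis .
qed

lemma profiles_nonempty: "is_game G \<Longrightarrow> profiles G \<noteq> {}"
  by (auto simp: profiles_def PiE_eq_empty_iff is_game_def)

section \<open>Varying the strategy of one player\<close>

lemma mixed_profiles_upd:
  assumes "p \<in> mixed_profiles G" "i < num_players G" "q \<in> mixed_strategies (strategies G i)"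
  shows "p(i := q) \<in> mixed_profiles G"
  using assms by (auto simp: mixed_profiles_def PiE_def Pi_def extensional_def)

lemma mix_in_mixed_strategies:
  assumes "q \<in> mixed_strategies S" "r \<in> mixed_strategies S" "0 \<le> t" "t \<le> 1"
  shows "mix t q r \<in> mixed_strategies S"
  using assms by (auto simp: mixed_strategies_def mix_def sum.distrib simp flip: sum_distrib_left)

text \<open>Only the factor of player \<open>i\<close> changes with the update; the product over the
  other players is a common coefficient.\<close>

lemma profile_prob_mix:
  assumes "i < num_players G"
  shows "profile_prob G (p(i := mix t q r)) s
    = t * profile_prob G (p(i := q)) s + (1 - t) * profile_prob G (p(i := r)) s"
proof -
  have "profile_prob G (p(i := u)) s = u (s i) * (\<Prod>j\<in>{..<num_players G} - {i}. p j (s j))" for u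
    using assms by (simp add: profile_prob_def prod.remove[of _ i])
  then show ?thesis
    by (simp add: mix_def algebra_simps)
qed

lemma mean_mix:
  assumes "i < num_players G"
  shows "mean G (p(i := mix t q r)) f = t * mean G (p(i := q)) f + (1 - t) * mean G (p(i := r)) f"
  by (simp add: mean_def profile_prob_mix[OF assms] sum_distrib_left distrib_right mult.assoc
      flip: sum.distrib)

section \<open>The variance\<close>

lemma Var_val_eq:
  assumes "is_game G" "p \<in> mixed_profiles G"
  shows "Var_val G i p = mean G p (\<lambda>s. (cost G i s)\<^sup>2) - (Exp_val G i p)\<^sup>2"
proof -
  let ?e = "Exp_val G i p"
  have "Var_val G i p = (\<Sum>s\<in>profiles G. profile_prob G p s * (cost G i s)\<^sup>2
      - 2 * ?e * (profile_prob G p s * cost G i s) + ?e\<^sup>2 * profile_prob G p s)"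
    unfolding Var_val_def by (intro sum.cong refl) (simp add: power2_eq_square algebra_simps)
  also have "\<dots> = mean G p (\<lambda>s. (cost G i s)\<^sup>2) - 2 * ?e * ?e + ?e\<^sup>2"
    by (simp add: sum.distrib sum_subtractf sum_profile_prob[OF assms] mean_def
        flip: sum_distrib_left Exp_val_def)
  finally show ?thesis
    by (simp add: power2_eq_square)
qed

text \<open>The second moment is affine in the mixture, so the excess comes from the squared
  expectation alone: t a^2 + (1 - t) b^2 - (t a + (1 - t) b)^2 = t (1 - t) (a - b)^2.\<close>

lemma Var_val_mix:
  assumes "is_game G" "p \<in> mixed_profiles G" "i < num_players G"
    and "q \<in> mixed_strategies (strategies G i)" "r \<in> mixed_strategies (strategies G i)"
    and "0 \<le> t" "t \<le> 1"
  shows "Var_val G i (p(i := mix t q r))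
    = t * Var_val G i (p(i := q)) + (1 - t) * Var_val G i (p(i := r))
      + t * (1 - t) * (Exp_val G i (p(i := q)) - Exp_val G i (p(i := r)))\<^sup>2"
proof -
  have "p(i := u) \<in> mixed_profiles G" if "u \<in> {q, r, mix t q r}" for u
    using that assms by (auto intro: mixed_profiles_upd mix_in_mixed_strategies)
  then show ?thesis
    by (simp add: Var_val_eq[OF assms(1)] Exp_val_eq_mean mean_mix[OF assms(3)])
      (simp add: power2_eq_square algebra_simps)
qed

lemma Var_val_nonneg:
  "p \<in> mixed_profiles G \<Longrightarrow> 0 \<le> Var_val G i p"
  unfolding Var_val_def by (intro sum_nonneg mult_nonneg_nonneg profile_prob_nonneg) auto

text \<open>Probabilities are nonnegative, so a profile outside the support has weight zero and the
  value of \<open>f\<close> there may be replaced by \<open>c\<close>.\<close>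

lemma mean_eq_on_support:
  assumes "is_game G" "p \<in> mixed_profiles G"
    and "\<And>s. s \<in> profiles G \<Longrightarrow> 0 < profile_prob G p s \<Longrightarrow> f s = c"
  shows "mean G p f = c"
proof -
  have "mean G p f = (\<Sum>s\<in>profiles G. profile_prob G p s * c)"
    unfolding mean_def
    using assms(3) profile_prob_nonneg[OF assms(2)] by (intro sum.cong refl) fastforce
  then show ?thesis
    by (simp add: sum_profile_prob[OF assms(1,2)] flip: sum_distrib_right)
qed

lemma Var_val_eq_0_iff:
  assumes "is_game G" "p \<in> mixed_profiles G"
  shows "Var_val G i p = 0 \<longleftrightarrow> cost G i constant_on {s \<in> profiles G. 0 < profile_prob G p s}"
proof
  assume "Var_val G i p = 0"
  \<comment> \<open>A vanishing sum of nonnegative terms vanishes termwise, so the cost equals its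
    expectation wherever the probability is positive.\<close>
  then have "\<forall>s\<in>profiles G. profile_prob G p s * (cost G i s - Exp_val G i p)\<^sup>2 = 0"
    unfolding Var_val_def using finite_profiles[OF assms(1)] profile_prob_nonneg[OF assms(2)]
    by (subst (asm) sum_nonneg_eq_0_iff) auto
  then show "cost G i constant_on {s \<in> profiles G. 0 < profile_prob G p s}"
    unfolding constant_on_def by (intro exI[of _ "Exp_val G i p"]) auto
next
  assume "cost G i constant_on {s \<in> profiles G. 0 < profile_prob G p s}"
  then obtain c where c: "\<And>s. s \<in> profiles G \<Longrightarrow> 0 < profile_prob G p s \<Longrightarrow> cost G i s = c"
    unfolding constant_on_def by auto
  have "mean G p (cost G i) = c" "mean G p (\<lambda>s. (cost G i s)\<^sup>2) = c\<^sup>2"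
    using c by (auto intro!: mean_eq_on_support[OF assms])
  then show "Var_val G i p = 0"
    by (simp add: Var_val_eq[OF assms] Exp_val_eq_mean)
qed

section \<open>Convexity and continuity of means\<close>

lemma mean_in_convex:
  assumes "is_game G" "p \<in> mixed_profiles G" "convex C" "\<And>s. s \<in> profiles G \<Longrightarrow> f s \<in> C"
  shows "mean G p f \<in> C"
  using convex_sum[OF finite_profiles[OF assms(1)] assms(3) sum_profile_prob[OF assms(1,2)]
      profile_prob_nonneg[OF assms(2)] assms(4)]
  by (simp add: mean_def)

lemma mean_Jensen:
  assumes "is_game G" "p \<in> mixed_profiles G" "convex_on C f" "\<And>s. s \<in> profiles G \<Longrightarrow> g s \<in> C"
  shows "f (mean G p g) \<le> mean G p (\<lambda>s. f (g s))"
  using convex_on_sum[OF finite_profiles[OF assms(1)] profiles_nonempty[OF assms(1)] assms(3)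
      sum_profile_prob[OF assms(1,2)] profile_prob_nonneg[OF assms(2)] assms(4)]
  by (simp add: mean_def)

text \<open>The mean is built by sums and products from the coordinates \<open>p i x\<close>; these
  are continuous by using the product topology twice, for the player and for the strategy.\<close>

lemma continuous_on_mean:
  fixes G :: "'s game"
  shows "continuous_on A (\<lambda>p. mean G p f)"
proof -
  have "continuous_on A (\<lambda>p :: nat \<Rightarrow> 's \<Rightarrow> real. p i x)" for i and x :: 's
    using continuous_on_product_then_coordinatewise[OF continuous_on_product_then_coordinatewise,
        OF continuous_on_id] .
  then show ?thesis
    unfolding mean_def profile_prob_def by (intro continuous_intros)
qed

section \<open>Increasing convex functions and their inverses\<close>

lemma strictly_convex_on_imp_convex_on:
  assumes "convex I" "strictly_convex_on I f"
  shows "convex_on I f"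
proof (rule convex_onI)
  fix t x y :: real
  assume t: "0 < t" "t < 1" and xy: "x \<in> I" "y \<in> I"
  show "f ((1 - t) *\<^sub>R x + t *\<^sub>R y) \<le> (1 - t) * f x + t * f y"
  proof (cases "x = y")
    case True
    then show ?thesis by (simp flip: distrib_right)
  next
    case False
    \<comment> \<open>\<open>strictly_convex_on\<close> puts the parameter on the first point and
      \<open>convex_onI\<close> on the second, hence the instance \<open>1 - t\<close>.\<close>
    then have "f ((1 - t) * x + (1 - (1 - t)) * y) < (1 - t) * f x + (1 - (1 - t)) * f y"
      using assms(2)[unfolded strictly_convex_on_def, rule_format, of x y "1 - t"] t xy by simp
    then show ?thesis by simp
  qed
qed fact

text \<open>The value at the midpoint is at least \<open>f x\<close> by monotonicity, yet strictly
  below the average of \<open>f x\<close> and \<open>f y\<close>.\<close>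

lemma strictly_convex_mono_imp_strict_mono:
  assumes "convex I" "strictly_convex_on I f" "mono_on I f"
  shows "strict_mono_on I f"
proof (rule strict_mono_onI)
  fix x y :: real
  assume xy: "x \<in> I" "y \<in> I" "x < y"
  let ?m = "1 / 2 * x + (1 - 1 / 2) * y"
  have "?m \<in> I"
    using assms(1) xy convexD[of I x y "1/2" "1/2"] by simp
  then have "f x \<le> f ?m"
    using assms(3) xy by (intro mono_onD[of I f]) auto
  also have "f ?m < 1 / 2 * f x + (1 - 1 / 2) * f y"
    using assms(2)[unfolded strictly_convex_on_def, rule_format, of x y "1 / 2"] xy by simp
  finally show "f x < f y" by simp
qed

text \<open>A continuous injection on an interval is a homeomorphism onto its image, and the inverse
  it provides agrees there with \<open>inv_into\<close>.\<close>

lemma continuous_on_inv_into_interval: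
  fixes f :: "real \<Rightarrow> real"
  assumes "is_interval I" "continuous_on I f" "inj_on f I"
  shows "continuous_on (f ` I) (inv_into I f)"
proof -
  obtain g where g: "homeomorphism I (f ` I) f g"
    using homeomorphism_into_1d assms is_interval_path_connected_1 by blast
  then have "continuous_on (f ` I) g"
    by (simp add: homeomorphism_def)
  moreover have "g y = inv_into I f y" if "y \<in> f ` I" for y
    using that g assms(3) by (auto simp: homeomorphism_def)
  ultimately show ?thesis
    using continuous_on_cong[OF refl, of "f ` I" g "inv_into I f"] by blast
qed

lemma concave_on_inv_into:
  fixes f :: "real \<Rightarrow> real"
  assumes "convex_on I f" "strict_mono_on I f" "convex (f ` I)"
  shows "concave_on (f ` I) (inv_into I f)"
  unfolding concave_on_iff
proof (intro conjI ballI allI impI)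
  fix a b u v :: real
  assume ab: "a \<in> f ` I" "b \<in> f ` I" and uv: "0 \<le> u" "0 \<le> v" "u + v = 1"
  let ?g = "inv_into I f"
  let ?c = "u *\<^sub>R a + v *\<^sub>R b" and ?d = "u *\<^sub>R ?g a + v *\<^sub>R ?g b"
  have gI: "?g a \<in> I" "?g b \<in> I"
    using ab by (auto intro: inv_into_into)
  have "?c \<in> f ` I"
    using convexD[OF assms(3) ab uv] .
  then have c: "?g ?c \<in> I" "f (?g ?c) = ?c"
    by (auto intro: inv_into_into f_inv_into_f)
  have d: "?d \<in> I"
    using convexD[OF convex_on_imp_convex[OF assms(1)] gI uv] .
  have "f ?d \<le> u * f (?g a) + v * f (?g b)"
    using assms(1) gI uv unfolding convex_on_def by blast
  then have "f ?d \<le> f (?g ?c)"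
    using c ab by (simp add: f_inv_into_f)
  \<comment> \<open>By contraposition: \<open>?g ?c < ?d\<close> would give
    \<open>f (?g ?c) < f ?d\<close>.\<close>
  then show "u * ?g a + v * ?g b \<le> ?g ?c"
    using strict_mono_onD[OF assms(2) c(1) d] by fastforce
qed fact

section \<open>The combined valuation\<close>

lemma E_strictly_concave_E_Var_nu:
  fixes I :: "real set" and \<nu> :: "real \<Rightarrow> real" and \<Lambda> \<gamma> :: real
  defines "V \<equiv> \<lambda>G i p. \<Lambda> * (Exp_val G i p + \<gamma> * Var_val G i p) + (1 - \<Lambda>) * nu_val I \<nu> G i p"
  assumes I: "is_interval I" and cont: "continuous_on I \<nu>" and conv: "convex_on I \<nu>"
    and smono: "strict_mono_on I \<nu>" and \<Lambda>: "0 < \<Lambda>" "\<Lambda> \<le> 1" and \<gamma>: "0 < \<gamma>"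
  shows "E_strictly_concave (games_with_costs_in I :: 's game set) V"
proof -
  let ?\<G> = "games_with_costs_in I :: 's game set"
  let ?g = "inv_into I \<nu>"
  let ?m = "\<lambda>G i p. mean G p (\<lambda>s. \<nu> (cost G i s))"
  have "convex I"
    using I is_interval_convex_1 by blast
  have inj: "inj_on \<nu> I"
    using smono strict_mono_on_imp_inj_on by blast
  have cJ: "convex (\<nu> ` I)"
    using connected_continuous_image[OF cont] I
    by (simp add: is_interval_connected_1 flip: is_interval_convex_1)
  have game: "is_game G" if "G \<in> ?\<G>" for G
    using that by (simp add: games_with_costs_in_def)
  have cost: "cost G i s \<in> I" if "G \<in> ?\<G>" "i < num_players G" "s \<in> profiles G" for G i s
    using that by (simp add: games_with_costs_in_def)
  \<comment> \<open>The image of \<open>I\<close> is convex, so the mean of \<nu> of the costs stays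
    where \<open>?g\<close> is a genuine inverse.\<close>
  have mJ: "?m G i p \<in> \<nu> ` I" if "G \<in> ?\<G>" "i < num_players G" "p \<in> mixed_profiles G" for G i p
    using that by (intro mean_in_convex game cJ) (auto intro: cost)
  have E_le: "Exp_val G i p \<le> nu_val I \<nu> G i p"
    if G: "G \<in> ?\<G>" "i < num_players G" "p \<in> mixed_profiles G" for G i p
  proof -
    have "mean G p (cost G i) \<in> I"
      using G cost \<open>convex I\<close> by (intro mean_in_convex game) auto
    moreover have "?g (?m G i p) \<in> I" "\<nu> (?g (?m G i p)) = ?m G i p"
      using mJ[OF G] by (auto intro: inv_into_into f_inv_into_f)
    \<comment> \<open>Jensen bounds \<nu> of the expectation by \<nu> of the \<nu>-valuation; strict
      monotonicity then cancels \<nu>.\<close>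
    moreover have "\<nu> (mean G p (cost G i)) \<le> ?m G i p"
      using G cost by (intro mean_Jensen[OF _ _ conv] game) auto
    ultimately show ?thesis
      unfolding Exp_val_eq_mean nu_val_eq_mean
      using strict_mono_onD[OF smono, of "?g (?m G i p)" "mean G p (cost G i)"] by linarith
  qed
  have const: "nu_val I \<nu> G i p = Exp_val G i p"
    if G: "G \<in> ?\<G>" "i < num_players G" "p \<in> mixed_profiles G"
      and const: "cost G i constant_on {s \<in> profiles G. 0 < profile_prob G p s}" for G i p
  proof -
    obtain c where c: "\<And>s. s \<in> profiles G \<Longrightarrow> 0 < profile_prob G p s \<Longrightarrow> cost G i s = c"
      using const unfolding constant_on_def by auto
    have *: "mean G p (cost G i) = c" "?m G i p = \<nu> c"
      using c by (auto intro!: mean_eq_on_support game G)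
    \<comment> \<open>This places \<open>c\<close> in \<open>I\<close>, so \<open>?g\<close> undoes
      \<nu> at \<open>c\<close>.\<close>
    moreover have "mean G p (cost G i) \<in> I"
      using G cost \<open>convex I\<close> by (intro mean_in_convex game) auto
    ultimately show ?thesis
      using inj by (simp add: Exp_val_eq_mean nu_val_eq_mean)
  qed
  have "ER_valuation ?\<G> V"
    unfolding ER_valuation_def
  \<comment> \<open>The witness is forced by the decomposition into expectation and risk.\<close>
  proof (intro exI[of _ "\<lambda>G i p. V G i p - Exp_val G i p"] ballI allI impI conjI)
    fix G :: "'s game" and i
    assume G: "G \<in> ?\<G>" "i < num_players G"
    \<comment> \<open>Everything is first expressed through means; \<open>mJ\<close> keeps the
      argument of \<open>?g\<close> in the set on which it is continuous.\<close>
    have "continuous_on (mixed_profiles G) (\<lambda>p. \<Lambda> * (Exp_val G i p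
        + \<gamma> * (mean G p (\<lambda>s. (cost G i s)\<^sup>2) - (Exp_val G i p)\<^sup>2))
        + (1 - \<Lambda>) * ?g (?m G i p) - Exp_val G i p)"
      using mJ[OF G] unfolding Exp_val_eq_mean
      by (intro continuous_intros continuous_on_mean
          continuous_on_compose2[OF continuous_on_inv_into_interval[OF I cont inj]]) auto
    then show "continuous_on (mixed_profiles G) (\<lambda>p. V G i p - Exp_val G i p)"
      by (rule continuous_on_cong[THEN iffD1, rotated -1])
        (simp_all add: V_def Var_val_eq[OF game[OF G(1)]] nu_val_eq_mean)
    fix p
    assume p: "p \<in> mixed_profiles G"
    have R: "V G i p - Exp_val G i p
        = \<Lambda> * \<gamma> * Var_val G i p + (1 - \<Lambda>) * (nu_val I \<nu> G i p - Exp_val G i p)"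
      by (simp add: V_def algebra_simps)
    have nonneg: "0 \<le> \<Lambda> * \<gamma> * Var_val G i p"
      "0 \<le> (1 - \<Lambda>) * (nu_val I \<nu> G i p - Exp_val G i p)"
      using E_le[OF G p] Var_val_nonneg[OF p] \<Lambda> \<gamma> by simp_all
    then show "0 \<le> V G i p - Exp_val G i p"
      unfolding R by (rule add_nonneg_nonneg)
    \<comment> \<open>Both summands of \<open>R\<close> must vanish. The first does so exactly for
      constant cost on the support, as \<open>\<Lambda> * \<gamma>\<close> is positive;
      \<open>const\<close> then removes the second.\<close>
    show "V G i p - Exp_val G i p = 0
        \<longleftrightarrow> cost G i constant_on {s \<in> profiles G. 0 < profile_prob G p s}"
      unfolding R add_nonneg_eq_0_iff[OF nonneg]
      using Var_val_eq_0_iff[OF game[OF G(1)] p, of i] const[OF G p] \<Lambda> \<gamma> by auto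
  qed simp
  \<comment> \<open>One quantitative bound serves both clauses: the extra term is nonnegative, and
    positive when the expectations differ and \<open>t\<close> lies strictly between 0 and
    1.\<close>
  moreover have gap: "t * V G i (p(i := q)) + (1 - t) * V G i (p(i := r))
      + \<Lambda> * \<gamma> * (t * (1 - t) * (Exp_val G i (p(i := q)) - Exp_val G i (p(i := r)))\<^sup>2)
      \<le> V G i (p(i := mix t q r))"
    if G: "G \<in> ?\<G>" "i < num_players G" "p \<in> mixed_profiles G"
      and q: "q \<in> mixed_strategies (strategies G i)" and r: "r \<in> mixed_strategies (strategies G i)"
      and t: "0 \<le> t" "t \<le> 1" for G i p q r t
  proof -
    have "t * nu_val I \<nu> G i (p(i := q)) + (1 - t) * nu_val I \<nu> G i (p(i := r))
        \<le> nu_val I \<nu> G i (p(i := mix t q r))"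
      using concave_onD[OF concave_on_inv_into[OF conv smono cJ], of "1 - t"] t
        mJ[OF G(1,2) mixed_profiles_upd[OF G(3,2) q]] mJ[OF G(1,2) mixed_profiles_upd[OF G(3,2) r]]
      by (simp add: nu_val_eq_mean mean_mix[OF G(2)])
    then have "(1 - \<Lambda>) * (t * nu_val I \<nu> G i (p(i := q)) + (1 - t) * nu_val I \<nu> G i (p(i := r)))
        \<le> (1 - \<Lambda>) * nu_val I \<nu> G i (p(i := mix t q r))"
      using \<Lambda> by (intro mult_left_mono) auto
    then show ?thesis
      unfolding V_def Var_val_mix[OF game[OF G(1)] G(3,2) q r t] Exp_val_eq_mean mean_mix[OF G(2)]
      by (simp add: algebra_simps)
  qed
  ultimately show ?thesis
    unfolding E_strictly_concave_def
  proof (intro conjI ballI allI impI)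
    fix G :: "'s game" and i p q r and t :: real
    assume asm: "G \<in> ?\<G>" "i < num_players G" "p \<in> mixed_profiles G"
      "q \<in> mixed_strategies (strategies G i)" "r \<in> mixed_strategies (strategies G i)"
    let ?e = "Exp_val G i (p(i := q)) - Exp_val G i (p(i := r))"
    {
      assume t: "0 \<le> t \<and> t \<le> 1"
      then have "0 \<le> \<Lambda> * \<gamma> * (t * (1 - t) * ?e\<^sup>2)"
        using \<Lambda> \<gamma> by simp
      then show "t * V G i (p(i := q)) + (1 - t) * V G i (p(i := r)) \<le> V G i (p(i := mix t q r))"
        using gap[OF asm, of t] t by linarith
    next
      assume "Exp_val G i (p(i := q)) \<noteq> Exp_val G i (p(i := r))" and t: "0 < t \<and> t < 1"
      then have "0 < \<Lambda> * \<gamma> * (t * (1 - t) * ?e\<^sup>2)"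
        using \<Lambda> \<gamma> by simp
      then show "t * V G i (p(i := q)) + (1 - t) * V G i (p(i := r)) < V G i (p(i := mix t q r))"
        using gap[OF asm, of t] t by linarith
    }
  qed
qed

theorem corollary2p4:
  fixes I :: "real set" and \<nu> :: "real \<Rightarrow> real" and \<Lambda> \<gamma> :: real
  assumes "is_interval I"
    and "continuous_on I \<nu>"
    and "mono_on I \<nu>"
    and "strictly_convex_on I \<nu>"
    and "0 < \<Lambda>" and "\<Lambda> \<le> 1"
    and "\<gamma> > 0"
  shows "E_strictly_concave (games_with_costs_in I :: 's game set)
           (\<lambda>G i p. \<Lambda> * (Exp_val G i p + \<gamma> * Var_val G i p) + (1 - \<Lambda>) * nu_val I \<nu> G i p)"
proof -
  have "convex I"
    using assms(1) is_interval_convex_1 by blast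
  \<comment> \<open>Strict convexity enters twice: it implies convexity, and it rules out flat
    pieces of the monotone function \<nu>, which makes \<nu> injective.\<close>
  note convex = strictly_convex_on_imp_convex_on[OF this assms(4)]
    and strict_mono = strictly_convex_mono_imp_strict_mono[OF this assms(4,3)]
  show ?thesis
    using E_strictly_concave_E_Var_nu[OF assms(1,2) convex strict_mono assms(5-7)] .
qed

end
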